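(* Let $(G,A)$ be a simple edge-weighted graph on vertices $v_1,\dots,v_n$, and let $(G_n,A_n)$ be the result of applying the star-clique operation to $v_n$. Then the map $\phi:S_G\to S_{G_n}$, $\phi(g_1,\dots,g_n)=(g_1,\dots,g_{n-1})$, is a well-defined surjective $\mathbb{Z}$-module homomorphism whose kernel is $\mathcal{F}_{n-1}\cup\mathcal{F}_n$.
   Context: An edge-weighted graph $(G,A)$ is a finite loopless graph (multiple edges allowed unless "simple" is stated) with vertices $v_1,\dots,v_n$ and a weight function $A$ from its edges to positive integers. A spline on $(G,A)$ is $(g_1,\dots,g_n)\in\mathbb{Z}^n$ with $g_i\equiv g_j\pmod{A(e)}$ for every edge $e$ joining $v_i$ and $v_j$; $S_G$ denotes the $\mathbb{Z}$-module of splines. Star-clique operation on a vertex $v$ of a simple graph with neighbours $w_1,\dots,w_d$ and edge $vw_k$ of weight $a_k$: delete $v$ and its incident edges and, for each pair $j<k$, add a new edge between $w_j$ and $w_k$ of weight $\gcd(a_j,a_k)$ (possibly creating multiple edges); all other vertices and edges are unchanged. Flow-up classes of $S_G$: for $0\le i<n$, $\mathcal{F}_i$ is the set of splines with $g_1=\cdots=g_i=0$ and $g_{i+1}\neq 0$; $\mathcal{F}_n=\{0\}$. *)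

theory Defs
  imports
    "HOL-Number_Theory.Cong"
    "HOL-Algebra.IntRing"
    "Jordan_Normal_Form.Missing_VectorSpace"
begin

text \<open>
  Edges are abstract labels carrying a two-element set of ends, so multiple edges are allowed.
  Vertices are natural numbers; the vertex \<open>v\<^sub>i\<close> of a graph on \<open>v\<^sub>1, \<dots>, v\<^sub>n\<close> is the number \<open>i\<close>.
\<close>

record 'e weighted_graph =
  verts :: "nat set"
  edges :: "'e set"
  ends :: "'e \<Rightarrow> nat set"
  weight :: "'e \<Rightarrow> int"

definition edge_weighted_graph :: "'e weighted_graph \<Rightarrow> bool" where
  "edge_weighted_graph G \<longleftrightarrow>
     finite (verts G) \<and> finite (edges G) \<and>
     (\<forall>e\<in>edges G. \<exists>i\<in>verts G. \<exists>j\<in>verts G. i \<noteq> j \<and> ends G e = {i, j}) \<and>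
     (\<forall>e\<in>edges G. 0 < weight G e)"

definition simple :: "'e weighted_graph \<Rightarrow> bool" where
  "simple G \<longleftrightarrow> inj_on (ends G) (edges G)"

definition splines :: "'e weighted_graph \<Rightarrow> (nat \<Rightarrow> int) set" where
  "splines G = {g \<in> verts G \<rightarrow>\<^sub>E UNIV.
     \<forall>e\<in>edges G. \<forall>i j. ends G e = {i, j} \<longrightarrow> [g i = g j] (mod weight G e)}"

text \<open>
  Tuples indexed by \<open>verts G\<close> are extensional functions, with pointwise operations. The ring
  fields \<open>mult\<close> and \<open>one\<close> of the record play no role in a module.
\<close>

definition spline_module :: "'e weighted_graph \<Rightarrow> (int, nat \<Rightarrow> int) module" where
  "spline_module G =
     \<lparr>carrier = splines G, mult = undefined, one = undefined,
      zero = (\<lambda>i\<in>verts G. 0),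
      add = (\<lambda>g h. \<lambda>i\<in>verts G. g i + h i),
      smult = (\<lambda>c g. \<lambda>i\<in>verts G. c * g i)\<rparr>"

definition neighbours :: "'e weighted_graph \<Rightarrow> nat \<Rightarrow> nat set" where
  "neighbours G v = {w. \<exists>e\<in>edges G. ends G e = {v, w}}"

text \<open>Meaningful only when exactly one edge joins \<open>v\<close> and \<open>w\<close>.\<close>

definition weight_between :: "'e weighted_graph \<Rightarrow> nat \<Rightarrow> nat \<Rightarrow> int" where
  "weight_between G v w = weight G (THE e. e \<in> edges G \<and> ends G e = {v, w})"

text \<open>
  The surviving edges are tagged \<open>Inl\<close>; the new edge joining neighbours \<open>j < k\<close> of \<open>v\<close> is
  \<open>Inr (j, k)\<close>. The tags keep a new edge distinct from an old one with the same ends.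
\<close>

definition star_clique :: "'e weighted_graph \<Rightarrow> nat \<Rightarrow> ('e + nat \<times> nat) weighted_graph" where
  "star_clique G v =
     \<lparr>verts = verts G - {v},
      edges = Inl ` {e \<in> edges G. v \<notin> ends G e} \<union>
              Inr ` {(j, k). j \<in> neighbours G v \<and> k \<in> neighbours G v \<and> j < k},
      ends = case_sum (ends G) (\<lambda>(j, k). {j, k}),
      weight = case_sum (weight G)
                 (\<lambda>(j, k). gcd (weight_between G v j) (weight_between G v k))\<rparr>"

text \<open>For graphs with vertex set \<open>{1..n}\<close> and \<open>i \<le> n\<close>.\<close>

definition flow_up_class :: "'e weighted_graph \<Rightarrow> nat \<Rightarrow> (nat \<Rightarrow> int) set" where
  "flow_up_class G i =
     (if i < card (verts G) then {g \<in> splines G. (\<forall>k\<in>{1..i}. g k = 0) \<and> g (i + 1) \<noteq> 0}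
      else {\<lambda>k\<in>verts G. 0})"

definition drop_last :: "nat \<Rightarrow> (nat \<Rightarrow> int) \<Rightarrow> nat \<Rightarrow> int" where
  "drop_last n g = restrict g {1..n - 1}"

lemma edge_weighted_graph_star_clique:
  assumes "edge_weighted_graph G" and "simple G"
  shows "edge_weighted_graph (star_clique G v)"
proof -
  have fin: "finite (verts G)" "finite (edges G)"
    and ends: "\<And>e. e \<in> edges G \<Longrightarrow> \<exists>i\<in>verts G. \<exists>j\<in>verts G. i \<noteq> j \<and> ends G e = {i, j}"
    and pos: "\<And>e. e \<in> edges G \<Longrightarrow> 0 < weight G e"
    using assms(1) by (auto simp: edge_weighted_graph_def)
  have nb: "w \<in> verts G \<and> w \<noteq> v \<and> 0 < weight_between G v w" if w: "w \<in> neighbours G v" for w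
  proof -
    obtain e where e: "e \<in> edges G" "ends G e = {v, w}"
      using w by (auto simp: neighbours_def)
    have "(THE e. e \<in> edges G \<and> ends G e = {v, w}) = e"
      using e assms(2) by (intro the_equality) (auto simp: simple_def inj_on_def)
    then have "weight_between G v w = weight G e" by (simp add: weight_between_def)
    moreover have "w \<in> verts G" "w \<noteq> v"
      using ends[OF e(1)] unfolding e(2) by (auto simp: doubleton_eq_iff)
    ultimately show ?thesis using pos[OF e(1)] by simp
  qed
  have "neighbours G v \<subseteq> verts G" using nb by blast
  then have "finite (neighbours G v)" using fin(1) finite_subset by blast
  then have "finite {(j, k). j \<in> neighbours G v \<and> k \<in> neighbours G v \<and> j < k}"
    by (rule_tac finite_subset[of _ "neighbours G v \<times> neighbours G v"]) auto
  moreover have "\<exists>i\<in>verts G - {v}. \<exists>j\<in>verts G - {v}. i \<noteq> j \<and> ends G e = {i, j}"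
    if e: "e \<in> edges G" "v \<notin> ends G e" for e
  proof -
    obtain i j where "i \<in> verts G" "j \<in> verts G" "i \<noteq> j" and "ends G e = {i, j}"
      using ends[OF e(1)] by blast
    moreover from this have "i \<noteq> v" "j \<noteq> v" using e(2) by simp_all
    ultimately show ?thesis by blast
  qed
  moreover have "\<exists>i\<in>verts G - {v}. \<exists>j'\<in>verts G - {v}. i \<noteq> j' \<and> {j, k} = {i, j'}"
    if "j \<in> neighbours G v" "k \<in> neighbours G v" "j < k" for j k
    by (rule bexI[of _ j], rule bexI[of _ k]) (use nb[OF that(1)] nb[OF that(2)] that(3) in simp_all)
  moreover have "0 < gcd (weight_between G v j) (weight_between G v k)"
    if "j \<in> neighbours G v" for j k
    using nb[OF that] by (simp add: gcd_pos_int)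
  ultimately show ?thesis
    unfolding edge_weighted_graph_def star_clique_def using fin pos
    by (simp add: ball_Un) blast
qed

end

theory Submission
  imports Defs
begin

text \<open>
  A spline on the star-clique graph extends to \<open>v\<close> iff the congruences
  \<open>x \<equiv> g w (mod a\<^sub>w)\<close>, one for each neighbour \<open>w\<close> of \<open>v\<close>, have a common solution. The clique edges
  say exactly that these congruences are pairwise compatible, which suffices by the Chinese
  remainder theorem for moduli that need not be coprime.
\<close>

section \<open>Chinese remaindering for moduli that need not be coprime\<close>

text \<open>Every candidate \<open>a + m * t\<close> is right modulo \<open>m\<close>. Being right
  modulo \<open>n\<close> asks for \<open>m * t\<close> congruent to \<open>b - a\<close>, which
  Bezout solves because \<open>gcd m n\<close> divides \<open>b - a\<close>.\<close>

lemma chinese_remainder_gcd_int: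
  fixes a b m n :: int
  assumes "[a = b] (mod gcd m n)"
  shows "\<exists>x. [x = a] (mod m) \<and> [x = b] (mod n)"
proof -
  have "gcd m n dvd b - a"
    using assms by (metis cong_iff_dvd_diff cong_sym)
  then obtain t where "[m * t = b - a] (mod n)"
    using cong_solve_dvd_int by blast
  then have "[a + m * t = b] (mod n)"
    by (simp add: cong_iff_dvd_diff algebra_simps)
  moreover have "[a + m * t = a] (mod m)"
    by (simp add: cong_iff_dvd_diff)
  ultimately show ?thesis by blast
qed

text \<open>By distributivity the gcd with an lcm is the lcm of the gcds, so any common multiple of
  the \<open>gcd (m i) n\<close> is a multiple of it. This turns pairwise compatibility into
  compatibility with a single merged modulus.\<close>

lemma gcd_Lcm_image_dvd_int:
  fixes m :: "'a \<Rightarrow> int"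
  assumes "finite A" and "\<And>i. i \<in> A \<Longrightarrow> gcd (m i) n dvd y"
  shows "gcd (Lcm (m ` A)) n dvd y"
  using assms
proof (induction A rule: finite_induct)
  case (insert i A)
  have "gcd (Lcm (m ` insert i A)) n = lcm (gcd (m i) n) (gcd (Lcm (m ` A)) n)"
    by (simp add: gcd.commute[of _ n] gcd_lcm_distrib)
  then show ?case using insert by (simp add: lcm_least)
qed simp

text \<open>A solution \<open>y\<close> for \<open>A\<close> may be moved by multiples of
  \<open>Lcm (m\<close>
  A)\<open>, so adding the index\<close>k\<open>is a two-modulus problem with moduli\<close>Lcm (m
  \<open>A)\<close> and \<open>m k\<close>.\<close>

lemma chinese_remainder_pairwise_int:
  fixes m u :: "'a \<Rightarrow> int"
  assumes "finite A"
    and "\<And>i j. i \<in> A \<Longrightarrow> j \<in> A \<Longrightarrow> [u i = u j] (mod gcd (m i) (m j))"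
  shows "\<exists>x. \<forall>i\<in>A. [x = u i] (mod m i)"
  using assms
proof (induction A rule: finite_induct)
  case (insert k A)
  then obtain y where y: "\<And>i. i \<in> A \<Longrightarrow> [y = u i] (mod m i)" by auto
  \<comment> \<open>Modulo this gcd, both \<open>y\<close> and \<open>u k\<close> are congruent to
    \<open>u i\<close>.\<close>
  have "gcd (m i) (m k) dvd y - u k" if "i \<in> A" for i
  proof -
    have "[y = u i] (mod gcd (m i) (m k))"
      using y[OF that] by (rule cong_dvd_modulus) simp
    also have "[u i = u k] (mod gcd (m i) (m k))"
      using insert.prems that by simp
    finally show ?thesis by (simp add: cong_iff_dvd_diff)
  qed
  then have "gcd (Lcm (m ` A)) (m k) dvd y - u k"
    by (rule gcd_Lcm_image_dvd_int[OF insert.hyps(1)])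
  then obtain x where x: "[x = y] (mod Lcm (m ` A))" "[x = u k] (mod m k)"
    using chinese_remainder_gcd_int by (metis cong_iff_dvd_diff)
  have "[x = u i] (mod m i)" if "i \<in> A" for i
    using cong_dvd_modulus[OF x(1)] y[OF that] that by (meson cong_trans dvd_Lcm imageI)
  with x(2) show ?case by auto
qed simp

section \<open>Splines and their module structure\<close>

lemma ends_subset_verts:
  assumes "edge_weighted_graph G" and "e \<in> edges G"
  shows "ends G e \<subseteq> verts G"
proof -
  obtain i j where "i \<in> verts G" "j \<in> verts G" "ends G e = {i, j}"
    using assms unfolding edge_weighted_graph_def by blast
  then show ?thesis by simp
qed

lemma splinesD:
  assumes "g \<in> splines G" and "e \<in> edges G" and "ends G e = {i, j}"
  shows "[g i = g j] (mod weight G e)"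
  using assms unfolding splines_def by blast

text \<open>The module operations are restrictions to \<open>verts G\<close>. Edges have their ends
  in \<open>verts G\<close>, so the congruences can be checked on the unrestricted function.\<close>

lemma restrict_in_splinesI:
  assumes "edge_weighted_graph G"
    and "\<And>e i j. e \<in> edges G \<Longrightarrow> ends G e = {i, j} \<Longrightarrow> [f i = f j] (mod weight G e)"
  shows "restrict f (verts G) \<in> splines G"
proof -
  have "[restrict f (verts G) i = restrict f (verts G) j] (mod weight G e)"
    if e: "e \<in> edges G" "ends G e = {i, j}" for e i j
  proof -
    have "i \<in> verts G" "j \<in> verts G"
      using ends_subset_verts[OF assms(1) e(1)] e(2) by simp_all
    then show ?thesis using assms(2)[OF e] by simp
  qed
  then show ?thesis unfolding splines_def by simp
qed

lemma splines_zero: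
  assumes "edge_weighted_graph G"
  shows "(\<lambda>i\<in>verts G. 0) \<in> splines G"
  by (rule restrict_in_splinesI[OF assms]) simp

lemma splines_add:
  assumes "edge_weighted_graph G" and "g \<in> splines G" and "h \<in> splines G"
  shows "(\<lambda>i\<in>verts G. g i + h i) \<in> splines G"
  by (rule restrict_in_splinesI[OF assms(1)])
    (intro cong_add splinesD[OF assms(2)] splinesD[OF assms(3)])

lemma splines_scale:
  assumes "edge_weighted_graph G" and "g \<in> splines G"
  shows "(\<lambda>i\<in>verts G. c * g i) \<in> splines G"
  by (rule restrict_in_splinesI[OF assms(1)]) (intro cong_scalar_left splinesD[OF assms(2)])

lemma splines_outside:
  assumes "g \<in> splines G" and "i \<notin> verts G"
  shows "g i = undefined"
  using assms unfolding splines_def by blast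

lemma module_spline_module:
  assumes G: "edge_weighted_graph G"
  shows "module \<Z> (spline_module G)"
proof (rule moduleI[OF int_is_cring])
  show "abelian_group (spline_module G)"
  proof (rule abelian_groupI)
    fix g assume "g \<in> carrier (spline_module G)"
    then show "\<exists>h\<in>carrier (spline_module G). h \<oplus>\<^bsub>spline_module G\<^esub> g = \<zero>\<^bsub>spline_module G\<^esub>"
      using splines_scale[OF G, of g "-1"]
      \<comment> \<open>The additive inverse is the scalar multiple by -1, so closure under scaling
        makes it a spline.\<close>
      by (intro bexI[of _ "\<lambda>i\<in>verts G. - 1 * g i"]) (auto simp: spline_module_def)
  \<comment> \<open>The law for zero is an equality of functions: off the vertices it holds because
    both sides are \<open>undefined\<close> there.\<close>
  qed (auto simp: spline_module_def splines_zero[OF G] splines_add[OF G] splines_outside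
        fun_eq_iff add_ac)
next
  fix a b :: int and g assume "g \<in> carrier (spline_module G)"
  then show "(a \<otimes>\<^bsub>\<Z>\<^esub> b) \<odot>\<^bsub>spline_module G\<^esub> g = a \<odot>\<^bsub>spline_module G\<^esub> (b \<odot>\<^bsub>spline_module G\<^esub> g)"
    by (simp add: spline_module_def fun_eq_iff)
next
  fix a b :: int and g assume "g \<in> carrier (spline_module G)"
  then show "(a \<oplus>\<^bsub>\<Z>\<^esub> b) \<odot>\<^bsub>spline_module G\<^esub> g
      = a \<odot>\<^bsub>spline_module G\<^esub> g \<oplus>\<^bsub>spline_module G\<^esub> b \<odot>\<^bsub>spline_module G\<^esub> g"
    by (simp add: spline_module_def fun_eq_iff distrib_right)
next
  fix a :: int and g h
  assume "g \<in> carrier (spline_module G)" and "h \<in> carrier (spline_module G)"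
  then show "a \<odot>\<^bsub>spline_module G\<^esub> (g \<oplus>\<^bsub>spline_module G\<^esub> h)
      = a \<odot>\<^bsub>spline_module G\<^esub> g \<oplus>\<^bsub>spline_module G\<^esub> a \<odot>\<^bsub>spline_module G\<^esub> h"
    by (simp add: spline_module_def fun_eq_iff distrib_left)
next
  fix a :: int and g assume "g \<in> carrier (spline_module G)"
  then show "a \<odot>\<^bsub>spline_module G\<^esub> g \<in> carrier (spline_module G)"
    by (simp add: spline_module_def splines_scale[OF G])
next
  fix g assume "g \<in> carrier (spline_module G)"
  then show "\<one>\<^bsub>\<Z>\<^esub> \<odot>\<^bsub>spline_module G\<^esub> g = g"
    by (simp add: spline_module_def splines_outside fun_eq_iff)
qed

section \<open>Restriction of splines to the star-clique graph\<close>

lemma finite_neighbours: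
  assumes "edge_weighted_graph G"
  shows "finite (neighbours G v)"
proof (rule finite_subset)
  show "neighbours G v \<subseteq> verts G"
    using ends_subset_verts[OF assms] by (fastforce simp: neighbours_def)
  show "finite (verts G)" using assms by (simp add: edge_weighted_graph_def)
qed

lemma weight_between_eq:
  assumes "simple G" and "e \<in> edges G" and "ends G e = {v, w}"
  shows "weight_between G v w = weight G e"
proof -
  have "(THE e. e \<in> edges G \<and> ends G e = {v, w}) = e"
    using assms by (intro the_equality) (auto simp: simple_def inj_on_def)
  then show ?thesis by (simp add: weight_between_def)
qed

text \<open>Removes the edge tags and the order \<open>j < k\<close> by symmetry of congruence and
  gcd, the case \<open>j = k\<close> being trivial. The last conjunct is then literally the
  hypothesis of \<open>chinese_remainder_pairwise_int\<close>.\<close>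

lemma splines_star_clique_iff:
  "g \<in> splines (star_clique G v) \<longleftrightarrow>
     g \<in> extensional (verts G - {v}) \<and>
     (\<forall>e\<in>edges G. v \<notin> ends G e \<longrightarrow>
        (\<forall>i j. ends G e = {i, j} \<longrightarrow> [g i = g j] (mod weight G e))) \<and>
     (\<forall>j\<in>neighbours G v. \<forall>k\<in>neighbours G v.
        [g j = g k] (mod gcd (weight_between G v j) (weight_between G v k)))"
  (is "_ \<longleftrightarrow> _ \<and> ?old \<and> ?clique g")
proof -
  \<comment> \<open>The right-hand side is what unfolding gives for the edges
    \<open>Inr (j, k)\<close>; the set of ends matches \<open>{i, i'}\<close> in either
    order.\<close>
  have "?clique g \<longleftrightarrow> (\<forall>j\<in>neighbours G v. \<forall>k\<in>neighbours G v. j < k \<longrightarrow>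
      (\<forall>i i'. {j, k} = {i, i'} \<longrightarrow>
        [g i = g i'] (mod gcd (weight_between G v j) (weight_between G v k))))" (is "_ \<longleftrightarrow> ?rhs")
  proof
    assume ?rhs
    show "?clique g"
    proof (intro ballI)
      fix j k assume jk: "j \<in> neighbours G v" "k \<in> neighbours G v"
      show "[g j = g k] (mod gcd (weight_between G v j) (weight_between G v k))"
      proof (cases j k rule: linorder_cases)
        case greater
        then have "[g k = g j] (mod gcd (weight_between G v k) (weight_between G v j))"
          using \<open>?rhs\<close> jk by blast
        then show ?thesis by (simp add: gcd.commute cong_sym_eq)
      qed (use \<open>?rhs\<close> jk in auto)
    qed
  next
    assume c: "?clique g"
    show ?rhs
    proof (intro ballI allI impI)
      fix j k i i' assume "j \<in> neighbours G v" "k \<in> neighbours G v" and ii': "{j, k} = {i, i'}"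
      then have "[g j = g k] (mod gcd (weight_between G v j) (weight_between G v k))"
        using c by blast
      then show "[g i = g i'] (mod gcd (weight_between G v j) (weight_between G v k))"
        using ii' by (auto simp: doubleton_eq_iff dest: cong_sym)
    qed
  qed
  moreover have "g \<in> splines (star_clique G v) \<longleftrightarrow>
      g \<in> extensional (verts G - {v}) \<and> ?old \<and> ?rhs"
    by (simp add: splines_def star_clique_def PiE_iff ball_Un) (simp add: Ball_def, blast)
  ultimately show ?thesis by (simp only:)
qed

lemma restrict_spline_star_clique:
  assumes "edge_weighted_graph G" and "simple G" and g: "g \<in> splines G"
  shows "restrict g (verts G - {v}) \<in> splines (star_clique G v)"
proof -
  have g_nb: "w \<in> verts G - {v} \<and> [g v = g w] (mod weight_between G v w)"
    if "w \<in> neighbours G v" for w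
  proof -
    obtain e where e: "e \<in> edges G" "ends G e = {v, w}"
      using \<open>w \<in> neighbours G v\<close> by (auto simp: neighbours_def)
    have "w \<noteq> v" using assms(1) e by (force simp: edge_weighted_graph_def doubleton_eq_iff)
    then show ?thesis
      using ends_subset_verts[OF assms(1) e(1)] e splinesD[OF g e]
      by (simp add: weight_between_eq[OF assms(2) e])
  qed
  show ?thesis
    unfolding splines_star_clique_iff
  proof (intro conjI ballI allI impI)
    fix e i j assume e: "e \<in> edges G" "v \<notin> ends G e" "ends G e = {i, j}"
    then have "i \<in> verts G - {v}" "j \<in> verts G - {v}"
      using ends_subset_verts[OF assms(1) e(1)] by auto
    then show "[restrict g (verts G - {v}) i = restrict g (verts G - {v}) j] (mod weight G e)"
      using splinesD[OF g e(1,3)] by (simp only: restrict_apply')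
  next
    fix j k assume jk: "j \<in> neighbours G v" "k \<in> neighbours G v"
    \<comment> \<open>The deleted value \<open>g v\<close> links the two neighbours: each is
      congruent to it modulo its own edge weight, hence modulo the gcd.\<close>
    have "[g v = g j] (mod gcd (weight_between G v j) (weight_between G v k))"
      "[g v = g k] (mod gcd (weight_between G v j) (weight_between G v k))"
      using g_nb jk by (auto intro: cong_dvd_modulus)
    then have "[g j = g k] (mod gcd (weight_between G v j) (weight_between G v k))"
      by (metis cong_sym cong_trans)
    then show "[restrict g (verts G - {v}) j = restrict g (verts G - {v}) k]
        (mod gcd (weight_between G v j) (weight_between G v k))"
      using g_nb[OF jk(1)] g_nb[OF jk(2)] by (simp only: restrict_apply')
  qed simp
qed

text \<open>This gives surjectivity. Changing the value at \<open>v\<close> affects only edges at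
  \<open>v\<close>, whose congruences are met by the remaindering solution \<open>x\<close>; all
  other edges survive in the star-clique graph.\<close>

lemma spline_star_clique_extends:
  assumes "edge_weighted_graph G" and "simple G" and "v \<in> verts G"
    and g: "g \<in> splines (star_clique G v)"
  shows "\<exists>x. g(v := x) \<in> splines G"
proof -
  obtain x where x: "\<And>w. w \<in> neighbours G v \<Longrightarrow> [x = g w] (mod weight_between G v w)"
    using chinese_remainder_pairwise_int[OF finite_neighbours[OF assms(1)], of v g "weight_between G v"]
      g by (auto simp: splines_star_clique_iff)
  \<comment> \<open>By simplicity the edge \<open>e\<close> is the only one joining \<open>v\<close>
    and \<open>w\<close>, so its weight is \<open>weight_between G v w\<close>.\<close>
  have x_cong: "[x = g w] (mod weight G e)" if "e \<in> edges G" "ends G e = {v, w}" for e w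
    using x[of w] that weight_between_eq[OF assms(2) that] by (auto simp: neighbours_def)
  have "[(g(v := x)) i = (g(v := x)) j] (mod weight G e)"
    if e: "e \<in> edges G" "ends G e = {i, j}" for e i j
  proof (cases "v \<in> {i, j}")
    case True
    have "i \<noteq> j" using assms(1) e by (force simp: edge_weighted_graph_def doubleton_eq_iff)
    with True show ?thesis
      using x_cong[OF e(1)] e(2) by (auto simp: insert_commute cong_sym_eq)
  next
    case False
    then show ?thesis using g e by (auto simp: splines_star_clique_iff)
  qed
  moreover have "g(v := x) \<in> extensional (verts G)"
    using g assms(3) by (auto simp: splines_star_clique_iff extensional_def)
  ultimately have "g(v := x) \<in> splines G"
    unfolding splines_def PiE_iff by blast
  then show ?thesis ..
qed

lemma restrict_splines_star_clique:
  assumes "edge_weighted_graph G" and "simple G" and "v \<in> verts G"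
  shows "(\<lambda>g. restrict g (verts G - {v})) ` splines G = splines (star_clique G v)"
proof
  show "(\<lambda>g. restrict g (verts G - {v})) ` splines G \<subseteq> splines (star_clique G v)"
    using restrict_spline_star_clique[OF assms(1,2)] by blast
  show "splines (star_clique G v) \<subseteq> (\<lambda>g. restrict g (verts G - {v})) ` splines G"
  proof
    fix g assume g: "g \<in> splines (star_clique G v)"
    then obtain x where "g(v := x) \<in> splines G"
      using spline_star_clique_extends[OF assms] by blast
    \<comment> \<open>Restriction resets \<open>v\<close> to \<open>undefined\<close>, which is the
      value of \<open>g\<close> there.\<close>
    moreover have "restrict (g(v := x)) (verts G - {v}) = g"
      using g by (auto simp: splines_star_clique_iff extensional_def fun_eq_iff)
    ultimately show "g \<in> (\<lambda>g. restrict g (verts G - {v})) ` splines G"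
      by (metis image_eqI)
  qed
qed

lemma mod_hom_restrict_star_clique:
  assumes "edge_weighted_graph G" and "simple G"
  shows "mod_hom \<Z> (spline_module G) (spline_module (star_clique G v))
           (\<lambda>g. restrict g (verts G - {v}))"
proof (intro mod_hom.intro mod_hom_axioms.intro)
  show "module \<Z> (spline_module G)" by (rule module_spline_module[OF assms(1)])
  show "module \<Z> (spline_module (star_clique G v))"
    by (rule module_spline_module[OF edge_weighted_graph_star_clique[OF assms]])
  have "verts (star_clique G v) = verts G - {v}" by (simp add: star_clique_def)
  then show "(\<lambda>g. restrict g (verts G - {v}))
      \<in> module_hom \<Z> (spline_module G) (spline_module (star_clique G v))"
    using restrict_spline_star_clique[OF assms]
    by (auto simp: module_hom_def spline_module_def fun_eq_iff)
qed

section \<open>Dropping the last coordinate, and its kernel\<close>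

theorem theorem3p6:
  fixes G :: "'e weighted_graph" and n :: nat
  assumes "1 \<le> n"
    and "edge_weighted_graph G" and "simple G" and "verts G = {1..n}"
  shows "mod_hom \<Z> (spline_module G) (spline_module (star_clique G n)) (drop_last n) \<and>
         drop_last n ` carrier (spline_module G) = carrier (spline_module (star_clique G n)) \<and>
         mod_hom.ker (spline_module G) (spline_module (star_clique G n)) (drop_last n)
           = flow_up_class G (n - 1) \<union> flow_up_class G n"
proof (intro conjI)
  have n: "n \<in> verts G" using assms(1,4) by simp
  have verts: "verts G - {n} = {1..n - 1}" unfolding assms(4) using assms(1) by auto
  have drop: "drop_last n = (\<lambda>g. restrict g (verts G - {n}))"
    by (simp add: drop_last_def verts fun_eq_iff)
  show hom: "mod_hom \<Z> (spline_module G) (spline_module (star_clique G n)) (drop_last n)"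
    unfolding drop by (rule mod_hom_restrict_star_clique[OF assms(2,3)])
  show "drop_last n ` carrier (spline_module G) = carrier (spline_module (star_clique G n))"
    unfolding drop using restrict_splines_star_clique[OF assms(2,3) n]
    by (simp add: spline_module_def)
  \<comment> \<open>The zero of the target is the zero function restricted to
    \<open>{1..n - 1}\<close>, so the kernel leaves only \<open>g n\<close> free.\<close>
  have "mod_hom.ker (spline_module G) (spline_module (star_clique G n)) (drop_last n) =
      {g \<in> splines G. \<forall>k\<in>{1..n - 1}. g k = 0}"
    unfolding mod_hom.ker_def[OF hom]
    by (auto simp only: spline_module_def star_clique_def drop_last_def verts fun_eq_iff
        restrict_def module.simps ring.simps partial_object.simps monoid.simps
        weighted_graph.simps mem_Collect_eq split: if_splits)
  also have "\<dots> = flow_up_class G (n - 1) \<union> flow_up_class G n"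
  proof -
    \<comment> \<open>Kernel elements split on \<open>g n\<close>. A nonzero value gives class
      \<open>n - 1\<close>, whose leading index is \<open>n - 1 + 1 = n\<close> as
      \<open>1 \<le> n\<close>; if \<open>g n = 0\<close>, the spline is zero, the sole element of
      class \<open>n\<close> since \<open>card (verts G) = n\<close>.\<close>
    have "g = (\<lambda>k\<in>verts G. 0)"
      if g: "g \<in> splines G" "\<forall>k\<in>{1..n - 1}. g k = 0" "g n = 0" for g
    proof
      fix k
      show "g k = (\<lambda>k\<in>verts G. 0) k"
      proof (cases "k \<in> verts G")
        case True
        then show ?thesis using g(2,3) verts by (cases "k = n") auto
      next
        case False
        then show ?thesis using splines_outside[OF g(1)] by simp
      qed
    qed
    then show ?thesis
      using assms(1,4) splines_zero[OF assms(2)] by (auto simp: flow_up_class_def)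
  qed
  finally show "mod_hom.ker (spline_module G) (spline_module (star_clique G n)) (drop_last n)
      = flow_up_class G (n - 1) \<union> flow_up_class G n" .
qed

end
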